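(* Let $\alpha\in(0,1)$, $\Omega=\{te^{i\theta}:0<\theta<\pi\alpha,\ t>0\}\subset\mathbb{C}$, and $p=a\in\mathbb{R}_+=(0,\infty)$, a point of $\partial\Omega$. Let $G$ be the conformal Neumann Green's function of $\Omega$ with pole at $p$, let $\Omega_r:=\{x\in\Omega:G(x)<\log r\}$, let $|\Omega_r|$ be the area of $\Omega_r$ and $|\Omega_r|'=\frac{d}{dr}|\Omega_r|$. Then $$\frac{4}{r}-\frac{2|\Omega_r|'}{|\Omega_r|}<0$$ for all sufficiently small $r>0$.
   Context: Conformal Neumann Green's function with boundary pole: $G(x)=\log|\psi(x)|$, where $\psi$ is a conformal bijection from $\Omega$ onto the upper half-plane $\mathbb{H}$, extending to a homeomorphism $\overline\Omega\to\overline{\mathbb{H}}$ (closures in $\mathbb{C}$), with $\psi(p)=0$. For this sector one takes $\psi(z)=(\alpha z)^{1/\alpha}-(\alpha a)^{1/\alpha}$ (principal branch). *)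

theory Defs
  imports "HOL-Complex_Analysis.Complex_Analysis"
begin

definition upper_half_plane :: "complex set" where
  "upper_half_plane = {z. Im z > 0}"

(* A single map psi on the closure carries both the conformal bijection and its homeomorphic
   extension; closures are taken in the plane, so no point at infinity is involved. *)
definition half_plane_map :: "complex set \<Rightarrow> complex \<Rightarrow> (complex \<Rightarrow> complex) \<Rightarrow> bool" where
  "half_plane_map \<Omega> p \<psi> \<longleftrightarrow>
     p \<in> frontier \<Omega> \<and>
     \<psi> holomorphic_on \<Omega> \<and>
     bij_betw \<psi> \<Omega> upper_half_plane \<and>
     (\<exists>\<phi>. homeomorphism (closure \<Omega>) (closure upper_half_plane) \<psi> \<phi>) \<and>
     \<psi> p = 0"

(* Rescaling psi by a positive factor changes G by an additive constant, so this is a predicate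
   on G rather than a function of the domain and the pole. *)
definition conformal_neumann_green :: "complex set \<Rightarrow> complex \<Rightarrow> (complex \<Rightarrow> real) \<Rightarrow> bool" where
  "conformal_neumann_green \<Omega> p G \<longleftrightarrow>
     (\<exists>\<psi>. half_plane_map \<Omega> p \<psi> \<and> (\<forall>x \<in> closure \<Omega> - {p}. G x = ln (cmod (\<psi> x))))"

definition sublevel :: "complex set \<Rightarrow> (complex \<Rightarrow> real) \<Rightarrow> real \<Rightarrow> complex set" where
  "sublevel \<Omega> G r = {x \<in> \<Omega>. G x < ln r}"

definition sublevel_area :: "complex set \<Rightarrow> (complex \<Rightarrow> real) \<Rightarrow> real \<Rightarrow> real" where
  "sublevel_area \<Omega> G r = measure lborel (sublevel \<Omega> G r)"

definition sector :: "real \<Rightarrow> complex set" where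
  "sector \<alpha> = {of_real t * cis \<theta> | t \<theta>. 0 < \<theta> \<and> \<theta> < pi * \<alpha> \<and> t > 0}"

definition sector_map :: "real \<Rightarrow> real \<Rightarrow> complex \<Rightarrow> complex" where
  "sector_map \<alpha> a z =
     (of_real \<alpha> * z) powr of_real (1 / \<alpha>) - (of_real \<alpha> * of_real a) powr of_real (1 / \<alpha>)"

lemma closure_upper_half_plane: "closure upper_half_plane = {z. Im z \<ge> 0}"
proof -
  have "closure {z. \<i> \<bullet> z > 0} = {z. \<i> \<bullet> z \<ge> 0}"
    by (rule closure_halfspace_gt) auto
  then show ?thesis
    by (simp add: upper_half_plane_def inner_complex_def)
qed

lemma powr_polar:
  assumes "t \<ge> 0" "- pi < \<theta>" "\<theta> \<le> pi"
  shows "(of_real t * cis \<theta>) powr (of_real s :: complex) = of_real (t powr s) * cis (s * \<theta>)"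
proof (cases "t = 0")
  case False
  then have t: "t > 0" using assms by simp
  have "Ln (of_real t * cis \<theta>) = Complex (ln t) \<theta>"
    using Ln_rcis[of t \<theta>] t assms by (simp add: rcis_def)
  then have "(of_real t * cis \<theta>) powr (of_real s :: complex) = exp (of_real s * Complex (ln t) \<theta>)"
    using t by (simp add: powr_def)
  also have "\<dots> = of_real (exp (s * ln t)) * cis (s * \<theta>)"
    by (simp add: exp_eq_polar)
  finally show ?thesis using t by (simp add: powr_def)
qed simp

lemma upper_polar:
  assumes "Im z \<ge> 0"
  obtains t \<theta> where "t \<ge> 0" "0 \<le> \<theta>" "\<theta> \<le> pi" "z = of_real t * cis \<theta>"
    "Im z > 0 \<longrightarrow> t > 0 \<and> 0 < \<theta> \<and> \<theta> < pi"
proof (cases "z = 0")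
  case True
  then show ?thesis using that[of 0 0] by simp
next
  case False
  have z: "z = of_real (cmod z) * cis (Arg z)"
    using rcis_cmod_Arg[of z] by (simp add: rcis_def)
  have a: "0 \<le> Arg z" "Arg z \<le> pi"
    using assms by (auto simp: Arg_less_0 Arg_le_pi linorder_not_less)
  have "Im z > 0 \<longrightarrow> cmod z > 0 \<and> 0 < Arg z \<and> Arg z < pi"
    by (auto simp: Arg_lt_pi False)
  with that[of "cmod z" "Arg z"] z a show ?thesis by simp
qed

lemma closed_sector:
  assumes "0 < \<alpha>" "\<alpha> < 1"
  shows "closed {of_real t * cis \<theta> | t \<theta>. 0 \<le> \<theta> \<and> \<theta> \<le> pi * \<alpha> \<and> t \<ge> 0}" (is "closed ?K")
proof -
  have pa: "0 < pi * \<alpha>" "pi * \<alpha> < pi" using assms by auto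
  have im: "Im (of_real t * cis \<theta> * cis (- (pi * \<alpha>))) = t * sin (\<theta> - pi * \<alpha>)" for t \<theta>
    by (simp add: mult.assoc cis_mult)
  have "?K = {z. Im z \<ge> 0} \<inter> {z. Im (z * cis (- (pi * \<alpha>))) \<le> 0}" (is "_ = ?R")
  proof (intro equalityI subsetI)
    fix z assume "z \<in> ?K"
    then obtain t \<theta> where z: "z = of_real t * cis \<theta>" and *: "0 \<le> \<theta>" "\<theta> \<le> pi * \<alpha>" "t \<ge> 0" by auto
    have "sin \<theta> \<ge> 0" by (rule sin_ge_zero) (use * pa in linarith)+
    moreover have "sin (pi * \<alpha> - \<theta>) \<ge> 0" by (rule sin_ge_zero) (use * pa in linarith)+
    then have "sin (\<theta> - pi * \<alpha>) \<le> 0" by (metis minus_diff_eq neg_0_le_iff_le sin_minus)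
    ultimately show "z \<in> ?R"
      unfolding z by (simp only: im Int_iff mem_Collect_eq) (use * in \<open>auto simp: mult_nonneg_nonpos\<close>)
  next
    fix z assume R: "z \<in> ?R"
    then have "Im z \<ge> 0" by simp
    from upper_polar[OF this] obtain t \<theta>
      where *: "t \<ge> 0" "0 \<le> \<theta>" "\<theta> \<le> pi" and z: "z = of_real t * cis \<theta>" .
    show "z \<in> ?K"
    proof (cases "t = 0 \<or> \<theta> \<le> pi * \<alpha>")
      case True
      then have "z = of_real t * cis (if t = 0 then 0 else \<theta>) \<and> 0 \<le> (if t = 0 then 0 else \<theta>) \<and>
          (if t = 0 then 0 else \<theta>) \<le> pi * \<alpha> \<and> t \<ge> 0"
        using z * pa by auto
      then show ?thesis by blast
    next
      case False
      then have "\<theta> > pi * \<alpha>" "t > 0" using * by auto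
      then have "sin (\<theta> - pi * \<alpha>) > 0" by (intro sin_gt_zero) (use * pa in linarith)+
      with \<open>t > 0\<close> have "t * sin (\<theta> - pi * \<alpha>) > 0" by simp
      moreover have "t * sin (\<theta> - pi * \<alpha>) \<le> 0"
        using R unfolding z by (simp only: im Int_iff mem_Collect_eq)
      ultimately show ?thesis by simp
    qed
  qed
  moreover have "closed ?R"
    by (intro closed_Int closed_Collect_le continuous_intros)
  ultimately show ?thesis by simp
qed

lemma sector_map_half_plane_map:
  assumes \<alpha>: "0 < \<alpha>" "\<alpha> < 1" and a: "0 < a"
  shows "half_plane_map (sector \<alpha>) (of_real a) (sector_map \<alpha> a)"
proof -
  let ?K = "{of_real t * cis \<theta> | t \<theta>. 0 \<le> \<theta> \<and> \<theta> \<le> pi * \<alpha> \<and> t \<ge> 0}"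
  let ?H = "{z. Im z \<ge> 0}"
  let ?\<psi> = "sector_map \<alpha> a"
  define c where "c = (\<alpha> * a) powr (1 / \<alpha>)"
  define F where "F w = (w + of_real c) powr of_real \<alpha> / of_real \<alpha>" for w :: complex
  have pa: "0 < pi * \<alpha>" "pi * \<alpha> < pi" using \<alpha> by auto
  have c: "(of_real \<alpha> * of_real a) powr of_real (1 / \<alpha>) = (of_real c :: complex)"
    using powr_polar[of "\<alpha> * a" 0 "1 / \<alpha>"] \<alpha> a by (simp add: c_def)
  have \<psi>: "?\<psi> (of_real t * cis \<theta>) = of_real ((\<alpha> * t) powr (1 / \<alpha>)) * cis (\<theta> / \<alpha>) - of_real c"
    if "0 \<le> \<theta>" "\<theta> \<le> pi * \<alpha>" "t \<ge> 0" for t \<theta>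
    using powr_polar[of "\<alpha> * t" \<theta> "1 / \<alpha>"] that \<alpha> pa c
    by (simp add: sector_map_def mult.assoc)
  have F: "F (of_real t * cis \<theta> - of_real c) = of_real (t powr \<alpha> / \<alpha>) * cis (\<alpha> * \<theta>)"
    if "0 \<le> \<theta>" "\<theta> \<le> pi" "t \<ge> 0" for t \<theta>
    using powr_polar[of t \<theta> \<alpha>] that pi_gt_zero by (simp add: F_def)
  have ang: "\<theta> / \<alpha> \<le> pi \<longleftrightarrow> \<theta> \<le> pi * \<alpha>" "\<theta> / \<alpha> < pi \<longleftrightarrow> \<theta> < pi * \<alpha>"
    "\<alpha> * \<theta> \<le> pi * \<alpha> \<longleftrightarrow> \<theta> \<le> pi" "\<alpha> * \<theta> < pi * \<alpha> \<longleftrightarrow> \<theta> < pi" for \<theta>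
    using \<alpha> by (auto simp: field_simps)
  have Hpol: "\<exists>t \<theta>. w = of_real t * cis \<theta> - of_real c \<and> t \<ge> 0 \<and> 0 \<le> \<theta> \<and> \<theta> \<le> pi \<and>
      (Im w > 0 \<longrightarrow> t > 0 \<and> 0 < \<theta> \<and> \<theta> < pi)" if "Im w \<ge> 0" for w
  proof -
    have "Im (w + of_real c) \<ge> 0" using that by simp
    from upper_polar[OF this] obtain t \<theta> where
      *: "t \<ge> 0" "0 \<le> \<theta>" "\<theta> \<le> pi" "w + of_real c = of_real t * cis \<theta>"
        "Im (w + of_real c) > 0 \<longrightarrow> t > 0 \<and> 0 < \<theta> \<and> \<theta> < pi" .
    have "w = of_real t * cis \<theta> - of_real c" using *(4) by (simp add: algebra_simps)
    with * show ?thesis by auto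
  qed
  have \<psi>K: "?\<psi> z \<in> ?H \<and> F (?\<psi> z) = z" if zK: "z \<in> ?K" for z
  proof -
    obtain t \<theta> where z: "z = of_real t * cis \<theta>" and *: "0 \<le> \<theta>" "\<theta> \<le> pi * \<alpha>" "t \<ge> 0"
      using zK by auto
    have "sin (\<theta> / \<alpha>) \<ge> 0" by (rule sin_ge_zero) (use * \<alpha> ang in auto)
    then have "?\<psi> z \<in> ?H" unfolding z \<psi>[OF *] by simp
    moreover have "F (?\<psi> z) = of_real (((\<alpha> * t) powr (1 / \<alpha>)) powr \<alpha> / \<alpha>) * cis (\<alpha> * (\<theta> / \<alpha>))"
      unfolding z \<psi>[OF *] by (rule F) (use * \<alpha> ang in auto)
    moreover have "((\<alpha> * t) powr (1 / \<alpha>)) powr \<alpha> / \<alpha> = t"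
      using \<alpha> * by (simp add: powr_powr)
    ultimately show ?thesis using \<alpha> z by simp
  qed
  have FH: "F w \<in> ?K \<and> ?\<psi> (F w) = w" if wH: "w \<in> ?H" for w
  proof -
    obtain t \<theta> where w: "w = of_real t * cis \<theta> - of_real c" and *: "0 \<le> \<theta>" "\<theta> \<le> pi" "t \<ge> 0"
      using Hpol[of w] wH by auto
    have Fw: "F w = of_real (t powr \<alpha> / \<alpha>) * cis (\<alpha> * \<theta>)" unfolding w by (rule F[OF *])
    have **: "0 \<le> \<alpha> * \<theta>" "\<alpha> * \<theta> \<le> pi * \<alpha>" "t powr \<alpha> / \<alpha> \<ge> 0" using * \<alpha> ang by auto
    have "F w \<in> ?K" unfolding Fw using ** by blast
    moreover have "?\<psi> (F w) = of_real t * cis \<theta> - of_real c"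
      unfolding Fw \<psi>[OF **] using \<alpha> * by (simp add: powr_powr)
    then have "?\<psi> (F w) = w" using w by simp
    ultimately show ?thesis by blast
  qed
  have \<psi>S: "?\<psi> z \<in> upper_half_plane" if zS: "z \<in> sector \<alpha>" for z
  proof -
    obtain t \<theta> where z: "z = of_real t * cis \<theta>" and *: "0 < \<theta>" "\<theta> < pi * \<alpha>" "t > 0"
      using zS by (auto simp: sector_def)
    have "sin (\<theta> / \<alpha>) > 0" by (rule sin_gt_zero) (use * \<alpha> ang in auto)
    moreover have "?\<psi> z = of_real ((\<alpha> * t) powr (1 / \<alpha>)) * cis (\<theta> / \<alpha>) - of_real c"
      unfolding z by (rule \<psi>) (use * in auto)
    ultimately show ?thesis using * \<alpha> by (simp add: upper_half_plane_def)
  qed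
  have FS: "F w \<in> sector \<alpha>" if wH: "w \<in> upper_half_plane" for w
  proof -
    obtain t \<theta> where w: "w = of_real t * cis \<theta> - of_real c" and *: "0 < \<theta>" "\<theta> < pi" "t > 0"
      using Hpol[of w] wH by (auto simp: upper_half_plane_def)
    have Fw: "F w = of_real (t powr \<alpha> / \<alpha>) * cis (\<alpha> * \<theta>)"
      unfolding w by (rule F) (use * in auto)
    have "0 < \<alpha> * \<theta>" "\<alpha> * \<theta> < pi * \<alpha>" "t powr \<alpha> / \<alpha> > 0" using * \<alpha> ang by auto
    then show ?thesis unfolding Fw sector_def by blast
  qed
  have SK: "sector \<alpha> \<subseteq> ?K" unfolding sector_def by force
  have UH: "upper_half_plane \<subseteq> ?H" by (auto simp: upper_half_plane_def)
  have upper: "Im z > 0" if zS: "z \<in> sector \<alpha>" for z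
  proof -
    obtain t \<theta> where z: "z = of_real t * cis \<theta>" and *: "0 < \<theta>" "\<theta> < pi * \<alpha>" "t > 0"
      using zS by (auto simp: sector_def)
    have "sin \<theta> > 0" by (rule sin_gt_zero) (use * pa in linarith)+
    then show ?thesis using z * by simp
  qed
  have K_sub: "Re z \<ge> 0 \<or> Im z \<noteq> 0" if zK: "z \<in> ?K" for z
  proof -
    obtain t \<theta> where z: "z = of_real t * cis \<theta>" and *: "0 \<le> \<theta>" "\<theta> \<le> pi * \<alpha>" "t \<ge> 0"
      using zK by auto
    show ?thesis
    proof (cases "t = 0 \<or> \<theta> = 0")
      case False
      then have "\<theta> \<noteq> 0" by simp
      then have "sin \<theta> > 0" by (intro sin_gt_zero) (use * pa in linarith)+
      then show ?thesis using z False by simp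
    qed (use z * in auto)
  qed
  have cont\<psi>: "continuous_on ?K ?\<psi>"
    unfolding sector_map_def
  proof (intro continuous_intros)
    show "?K \<subseteq> {z. 0 \<le> Re (of_real \<alpha> * z) \<or> Im (of_real \<alpha> * z) \<noteq> 0}"
      using K_sub \<alpha> by (auto simp: zero_le_mult_iff)
    show "0 < Re (of_real (1 / \<alpha>))" using \<alpha> by simp
  qed
  have contF: "continuous_on ?H F"
  proof -
    let ?g = "\<lambda>w. cis (\<alpha> * pi / 2) * (- \<i> * (w + of_real c)) powr of_real \<alpha> / of_real \<alpha>"
    have "continuous_on ?H ?g"
      by (intro continuous_intros) (use \<alpha> in auto)
    moreover have "F w = ?g w" if wH: "w \<in> ?H" for w
    proof -
      obtain t \<theta> where w: "w = of_real t * cis \<theta> - of_real c" and *: "0 \<le> \<theta>" "\<theta> \<le> pi" "t \<ge> 0"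
        using Hpol[of w] wH by auto
      have "cis (\<theta> - pi / 2) = - \<i> * cis \<theta>"
        by (simp add: complex_eq_iff sin_diff cos_diff)
      then have "- \<i> * (w + of_real c) = of_real t * cis (\<theta> - pi / 2)"
        by (simp add: w)
      then have "?g w = cis (\<alpha> * pi / 2) * (of_real (t powr \<alpha>) * cis (\<alpha> * (\<theta> - pi / 2))) / of_real \<alpha>"
        using powr_polar[of t "\<theta> - pi / 2" \<alpha>] * pi_gt_zero by simp
      also have "\<dots> = of_real (t powr \<alpha> / \<alpha>) * (cis (\<alpha> * pi / 2) * cis (\<alpha> * (\<theta> - pi / 2)))"
        by simp
      also have "cis (\<alpha> * pi / 2) * cis (\<alpha> * (\<theta> - pi / 2)) = cis (\<alpha> * \<theta>)"
        by (simp add: cis_mult algebra_simps)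
      finally have g: "?g w = of_real (t powr \<alpha> / \<alpha>) * cis (\<alpha> * \<theta>)" .
      have "F w = of_real (t powr \<alpha> / \<alpha>) * cis (\<alpha> * \<theta>)" unfolding w by (rule F[OF *])
      from this g[symmetric] show ?thesis by (rule trans)
    qed
    ultimately show ?thesis using continuous_on_eq[of ?H ?g F] by metis
  qed
  have clo: "closure (sector \<alpha>) = ?K"
  proof
    show "closure (sector \<alpha>) \<subseteq> ?K"
      by (rule closure_minimal[OF SK closed_sector[OF \<alpha>]])
    have "F ` closure upper_half_plane \<subseteq> closure (sector \<alpha>)"
    proof (rule image_closure_subset)
      show "continuous_on (closure upper_half_plane) F"
        using contF by (simp add: closure_upper_half_plane)
      show "F ` upper_half_plane \<subseteq> closure (sector \<alpha>)"
        using FS closure_subset by blast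
    qed simp
    then have FH_clo: "F w \<in> closure (sector \<alpha>)" if "w \<in> ?H" for w
      using that by (auto simp: closure_upper_half_plane)
    show "?K \<subseteq> closure (sector \<alpha>)"
    proof
      fix z assume "z \<in> ?K"
      from \<psi>K[OF this] FH_clo[of "?\<psi> z"] show "z \<in> closure (sector \<alpha>)" by simp
    qed
  qed
  have bij: "bij_betw ?\<psi> (sector \<alpha>) upper_half_plane"
  proof (rule bij_betw_byWitness[where f' = F])
    show "\<forall>z\<in>sector \<alpha>. F (?\<psi> z) = z"
      using \<psi>K[THEN conjunct2, OF subsetD[OF SK]] by (rule ballI)
    show "\<forall>w\<in>upper_half_plane. ?\<psi> (F w) = w"
      using FH[THEN conjunct2, OF subsetD[OF UH]] by (rule ballI)
  qed (use \<psi>S FS in auto)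
  have hom: "homeomorphism (closure (sector \<alpha>)) (closure upper_half_plane) ?\<psi> F"
    unfolding clo closure_upper_half_plane
  proof (rule homeomorphismI[OF cont\<psi> contF])
    show "?\<psi> ` ?K \<subseteq> ?H"
      using \<psi>K[THEN conjunct1] by (rule image_subsetI)
    show "F ` ?H \<subseteq> ?K"
      using FH[THEN conjunct1] by (rule image_subsetI)
  qed (rule \<psi>K[THEN conjunct2] FH[THEN conjunct2], assumption)+
  have hol: "?\<psi> holomorphic_on sector \<alpha>"
    unfolding sector_map_def
    by (intro holomorphic_intros) (use upper \<alpha> in \<open>force simp: complex_nonpos_Reals_iff\<close>)
  have "of_real a = (of_real a * cis 0 :: complex) \<and> 0 \<le> (0 :: real) \<and> 0 \<le> pi * \<alpha> \<and> a \<ge> 0"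
    using a pa by simp
  then have "of_real a \<in> ?K" by blast
  then have "of_real a \<in> closure (sector \<alpha>)" by (simp only: clo)
  moreover have "of_real a \<notin> interior (sector \<alpha>)"
    using upper[OF subsetD[OF interior_subset], of "of_real a"] by auto
  ultimately have fr: "of_real a \<in> frontier (sector \<alpha>)"
    unfolding frontier_def by (rule DiffI)
  have "?\<psi> (of_real a) = 0" by (simp add: sector_map_def)
  then show ?thesis
    unfolding half_plane_map_def by (intro conjI exI[of _ F] fr hol bij hom)
qed

lemma sector_conformal_neumann_green:
  assumes "0 < \<alpha>" "\<alpha> < 1" "0 < a"
  shows "conformal_neumann_green (sector \<alpha>) (of_real a) (\<lambda>z. ln (cmod (sector_map \<alpha> a z)))"
  unfolding conformal_neumann_green_def
  by (intro exI[of _ "sector_map \<alpha> a"] conjI ballI refl sector_map_half_plane_map assms)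

end

theory Submission
  imports Defs
begin

text \<open>
  Write \<open>\<psi>\<close> for the map of the sector onto the upper half plane that defines \<open>G\<close>.
  The sublevel set at level \<open>r\<close> is the preimage of the upper half disc of radius
  \<open>r\<close> under \<open>\<psi>\<close>, and its area \<open>A(r)\<close> can be computed exactly.

  First, \<open>\<psi>\<close> is \<open>sector_map\<close> up to a nonzero factor
  (\<open>half_plane_map_unique_up_to_factor\<close>): the transition map is an automorphism of the closed
  half plane fixing the origin, and by Schwarz reflection it extends to an injective entire function,
  which must be linear. A factor only rescales \<open>r\<close>, so the sublevel set becomes the image of
  the half disc of some radius \<open>\<rho> = r/\<kappa>\<close> under \<open>w \<mapsto> a (1 + w) powr \<alpha>\<close>.

  This image has area equal to the integral of the squared modulus of the derivative
  \<open>a \<alpha> (1 + w) powr (\<alpha> - 1)\<close> (\<open>area_conformal_image\<close>). The derivative has a power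
  series with real coefficients \<open>a \<alpha> b\<^sub>n\<close>, where \<open>b\<^sub>n = (\<alpha> - 1) gchoose n\<close>, so Parseval's
  identity on half circles (\<open>half_circle_parseval\<close>) gives, for \<open>\<rho> < 1\<close>,
  \<open>A = (a \<alpha>)\<^sup>2 (\<pi>/2) \<Sum> b\<^sub>n\<^sup>2 \<rho>\<^sup>2\<^sup>n\<^sup>+\<^sup>2 / (n + 1)\<close>
  (\<open>sector_map_sublevel_area\<close>).

  The claimed inequality says \<open>r A'(r) > 2 A(r)\<close>. The operator \<open>r d/dr\<close> multiplies the
  \<open>n\<close>-th term by \<open>2n + 2\<close>, so every term contributes at least twice itself, and the term
  \<open>n = 1\<close> contributes strictly more because \<open>b\<^sub>1 = \<alpha> - 1\<close> is nonzero
  (\<open>area_series_less\<close>). The argument covers all \<open>r\<close> below \<open>\<kappa>\<close>, the level at which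
  the half disc reaches the image of the corner.
\<close>

section \<open>Areas of conformal images\<close>

text \<open>
  Lebesgue measure only depends on the volumes of coordinate boxes, so it is transported by every
  linear map that relabels the standard basis. This identifies the plane as \<open>complex\<close>, as
  \<open>real \<times> real\<close> and as \<open>real^2\<close>: the first carries the complex analysis, the second
  Fubini's theorem and the third the change of variables formula.
\<close>
lemma lborel_distr_basis_isometry:
  fixes T :: "'a::euclidean_space \<Rightarrow> 'b::euclidean_space"
  assumes T: "linear T" and basis: "bij_betw T Basis Basis"
  shows "distr lborel borel T = lborel"
proof -
  define T' where "T' y = (\<Sum>b\<in>Basis. (y \<bullet> T b) *\<^sub>R b)" for y
  have inner: "T x \<bullet> T b = x \<bullet> b" if "b \<in> Basis" for x b
  proof -
    have "T x = (\<Sum>c\<in>Basis. (x \<bullet> c) *\<^sub>R T c)"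
      by (subst euclidean_representation[symmetric, of x]) (simp add: linear_sum[OF T] linear_scale[OF T])
    moreover have "T c \<bullet> T b = (if c = b then 1 else 0)" if "c \<in> Basis" for c
      using that \<open>b \<in> Basis\<close> basis
      by (metis bij_betw_apply bij_betw_imp_inj_on inj_on_contraD inner_Basis)
    then have "(\<Sum>c\<in>Basis. (x \<bullet> c) * (T c \<bullet> T b)) = (\<Sum>c\<in>Basis. if c = b then x \<bullet> c else 0)"
      by (intro sum.cong) auto
    ultimately show ?thesis
      using that by (simp add: inner_sum_left)
  qed
  have range: "\<exists>c\<in>Basis. b = T c" if "b \<in> Basis" for b
    using basis that by (auto simp: bij_betw_def)
  have [measurable]: "T \<in> borel_measurable borel"
    by (intro borel_measurable_continuous_onI linear_continuous_on) (simp add: T linear_linear)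
  have "lborel = distr lborel borel T"
  proof (rule lborel_eqI)
    fix l u :: 'b assume lu: "\<And>b. b \<in> Basis \<Longrightarrow> l \<bullet> b \<le> u \<bullet> b"
    have T': "T' y \<bullet> b = y \<bullet> T b" if "b \<in> Basis" for y b
      using that by (simp add: T'_def inner_sum_left inner_Basis if_distrib cong: if_cong)
    have "T -` box l u = box (T' l) (T' u)"
      using bij_betw_apply[OF basis] range by (force simp: box_def T' inner)
    moreover have "T' l \<bullet> b \<le> T' u \<bullet> b" if "b \<in> Basis" for b
      using that lu bij_betw_apply[OF basis] by (simp add: T')
    ultimately have "emeasure (distr lborel borel T) (box l u) = ennreal (\<Prod>b\<in>Basis. (T' u - T' l) \<bullet> b)"
      by (simp add: emeasure_distr)
    also have "(\<Prod>b\<in>Basis. (T' u - T' l) \<bullet> b) = (\<Prod>b\<in>Basis. (u - l) \<bullet> T b)"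
      by (intro prod.cong refl) (simp add: T' inner_diff_left)
    also have "\<dots> = (\<Prod>b\<in>Basis. (u - l) \<bullet> b)"
      using prod.reindex_bij_betw[OF basis] by simp
    finally show "emeasure (distr lborel borel T) (box l u) = (\<Prod>b\<in>Basis. (u - l) \<bullet> b)"
      by (simp add: prod_ennreal lu inner_diff_left)
  qed simp
  then show ?thesis by simp
qed

lemma distr_lborel_Complex: "distr (lborel \<Otimes>\<^sub>M lborel) borel (\<lambda>(x, y). Complex x y) = lborel"
  unfolding lborel_prod
proof (rule lborel_distr_basis_isometry)
  show "linear (\<lambda>(x, y). Complex x y)"
    by (rule linearI) (auto simp: complex_eq_iff)
  show "bij_betw (\<lambda>(x, y). Complex x y) Basis Basis"
    by (auto simp: bij_betw_def Basis_prod_def Basis_complex_def inj_on_def complex_eq_iff)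
qed

definition complex_of_vec :: "real^2 \<Rightarrow> complex" where
  "complex_of_vec v = Complex (v $ 1) (v $ 2)"

definition vec_of_complex :: "complex \<Rightarrow> real^2" where
  "vec_of_complex z = vector [Re z, Im z]"

lemma complex_vec_sel [simp]:
  "Re (complex_of_vec v) = v $ 1" "Im (complex_of_vec v) = v $ 2"
  "vec_of_complex z $ 1 = Re z" "vec_of_complex z $ 2 = Im z"
  by (simp_all add: complex_of_vec_def vec_of_complex_def)

lemma linear_complex_of_vec: "linear complex_of_vec"
  by (rule linearI) (auto simp: complex_eq_iff)

lemma linear_vec_of_complex: "linear vec_of_complex"
  by (rule linearI) (auto simp: vec_eq_iff forall_2)

lemma vec_complex_inverse [simp]:
  "complex_of_vec (vec_of_complex z) = z" "vec_of_complex (complex_of_vec v) = v"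
  by (auto simp: complex_eq_iff vec_eq_iff forall_2)

lemma distr_lborel_complex_of_vec: "distr lborel borel complex_of_vec = lborel"
proof (rule lborel_distr_basis_isometry[OF linear_complex_of_vec])
  have B: "(Basis :: (real^2) set) = {axis 1 1, axis 2 1}"
    by (auto simp: Basis_vec_def UNIV_2)
  show "bij_betw complex_of_vec Basis Basis"
    unfolding B by (auto simp: bij_betw_def Basis_complex_def inj_on_def complex_eq_iff axis_def)
qed

text \<open>
  The change of variables formula speaks of gauge integrals with a prescribed value, whereas the
  areas below are computed with extended nonnegative integrals.
\<close>
lemma has_integral_iff_nn_integral_lborel:
  fixes f :: "'a::euclidean_space \<Rightarrow> real"
  assumes [measurable]: "f \<in> borel_measurable borel" "S \<in> sets borel" and nonneg: "\<And>x. 0 \<le> f x"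
    and "0 \<le> m"
  shows "(f has_integral m) S \<longleftrightarrow> (\<integral>\<^sup>+x\<in>S. ennreal (f x) \<partial>lborel) = ennreal m"
proof
  assume "(f has_integral m) S"
  then show "(\<integral>\<^sup>+x\<in>S. ennreal (f x) \<partial>lborel) = ennreal m"
    using nn_integral_has_integral_lebesgue[of S f m] nonneg
    by (simp add: ennreal_mult' ennreal_indicator mult.commute)
next
  assume *: "(\<integral>\<^sup>+x\<in>S. ennreal (f x) \<partial>lborel) = ennreal m"
  have "((\<lambda>x. f x * indicator S x) has_integral m) UNIV"
  proof (rule nn_integral_has_integral)
    show "(\<integral>\<^sup>+x. ennreal (f x * indicator S x) \<partial>lborel) = ennreal m"
      using * by (simp add: ennreal_mult'' ennreal_indicator nonneg)
  qed (use nonneg \<open>0 \<le> m\<close> in auto)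
  moreover have "(\<lambda>x. f x * indicator S x) = (\<lambda>x. if x \<in> S then f x else 0)"
    by auto
  ultimately show "(f has_integral m) S"
    by (simp add: has_integral_restrict_UNIV)
qed

text \<open>
  The real derivative of a holomorphic map is multiplication by \<open>deriv h u\<close>, a rotation
  followed by a scaling, so its Jacobian determinant is \<open>(cmod (deriv h u))\<^sup>2\<close>. With
  extended nonnegative integrals the formula also covers images of infinite area.
\<close>
theorem area_conformal_image:
  assumes S: "open S" and hol: "h holomorphic_on S" and inj: "inj_on h S"
  shows "emeasure lborel (h ` S) = (\<integral>\<^sup>+u\<in>S. ennreal ((cmod (deriv h u))\<^sup>2) \<partial>lborel)"
proof -
  define V where "V = complex_of_vec -` S"
  define f where "f = vec_of_complex \<circ> h \<circ> complex_of_vec"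
  define f' where "f' x = vec_of_complex \<circ> (\<lambda>v. deriv h (complex_of_vec x) * v) \<circ> complex_of_vec" for x
  define J where "J x = indicator V x * (cmod (deriv h (complex_of_vec x)))\<^sup>2" for x
  have bl: "bounded_linear complex_of_vec" "bounded_linear vec_of_complex"
    using linear_complex_of_vec linear_vec_of_complex by (auto simp: linear_linear)
  have [measurable]: "complex_of_vec \<in> borel_measurable borel"
    by (intro borel_measurable_continuous_onI linear_continuous_on bl)
  have V: "open V"
    unfolding V_def by (intro open_vimage S linear_continuous_on bl)
  have hS: "open (h ` S)" by (rule open_mapping_thm3[OF hol S inj])
  have [measurable]: "V \<in> sets borel" "S \<in> sets borel" "h ` S \<in> sets borel" using V S hS by auto
  have "inj_on f V"
  proof (rule inj_onI)
    fix x y assume "x \<in> V" "y \<in> V" "f x = f y"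
    then have "h (complex_of_vec x) = h (complex_of_vec y)"
      by (metis comp_apply f_def vec_complex_inverse(1))
    then have "complex_of_vec x = complex_of_vec y"
      using inj \<open>x \<in> V\<close> \<open>y \<in> V\<close> unfolding V_def by (simp only: vimage_eq inj_onD[OF inj])
    then show "x = y"
      by (metis vec_complex_inverse(2))
  qed
  have fV: "f ` V = complex_of_vec -` (h ` S)"
  proof (intro equalityI subsetI)
    fix y assume "y \<in> complex_of_vec -` (h ` S)"
    then obtain u where "u \<in> S" "complex_of_vec y = h u" by auto
    then have "vec_of_complex u \<in> V" "f (vec_of_complex u) = vec_of_complex (complex_of_vec y)"
      by (auto simp: f_def V_def)
    then show "y \<in> f ` V" by (auto simp: image_iff intro!: bexI[of _ "vec_of_complex u"])
  qed (auto simp: f_def V_def)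
  have der: "(f has_derivative f' x) (at x within V)" if "x \<in> V" for x
  proof -
    have "(h has_field_derivative deriv h (complex_of_vec x)) (at (complex_of_vec x))"
      using that V_def hol S holomorphic_derivI by blast
    then have "(h has_derivative (\<lambda>v. deriv h (complex_of_vec x) * v)) (at (complex_of_vec x))"
      by (simp add: has_field_derivative_def)
    from diff_chain_at[OF bounded_linear_imp_has_derivative[OF bl(1)]
        diff_chain_at[OF this bounded_linear_imp_has_derivative[OF bl(2)]]]
    show ?thesis
      unfolding f_def f'_def comp_assoc by (rule has_derivative_at_withinI)
  qed
  have det: "\<bar>det (matrix (f' x))\<bar> = (cmod (deriv h (complex_of_vec x)))\<^sup>2" for x
    unfolding cmod_power2 by (simp add: det_2 matrix_def f'_def axis_def power2_eq_square)
  have Jm: "J \<in> borel_measurable borel"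
  proof -
    have "continuous_on V (\<lambda>x. deriv h (complex_of_vec x))"
      by (rule continuous_on_compose2[OF holomorphic_on_imp_continuous_on[OF holomorphic_deriv[OF hol S]]])
        (auto simp: V_def intro!: linear_continuous_on bl)
    then have "continuous_on V (\<lambda>x. (cmod (deriv h (complex_of_vec x)))\<^sup>2)"
      by (intro continuous_intros)
    then show ?thesis
      using borel_measurable_continuous_on_indicator[of V "\<lambda>x. (cmod (deriv h (complex_of_vec x)))\<^sup>2"]
      by (simp add: J_def[abs_def])
  qed
  have emeasure: "emeasure lborel (h ` S) = emeasure lborel (f ` V)"
    unfolding fV by (subst distr_lborel_complex_of_vec[symmetric]) (simp add: emeasure_distr)
  have "(\<integral>\<^sup>+u\<in>S. ennreal ((cmod (deriv h u))\<^sup>2) \<partial>lborel) = (\<integral>\<^sup>+u. ennreal (indicator S u * (cmod (deriv h u))\<^sup>2) \<partial>lborel)"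
    by (simp add: ennreal_mult' ennreal_indicator mult.commute)
  also have "\<dots> = (\<integral>\<^sup>+x. ennreal (J x) \<partial>lborel)"
  proof -
    have "continuous_on S (\<lambda>u. (cmod (deriv h u))\<^sup>2)"
      by (intro continuous_intros holomorphic_on_imp_continuous_on holomorphic_deriv hol S)
    then have "(\<lambda>u. ennreal (indicator S u * (cmod (deriv h u))\<^sup>2)) \<in> borel_measurable borel"
      using borel_measurable_continuous_on_indicator[of S "\<lambda>u. (cmod (deriv h u))\<^sup>2"] by simp
    then have "(\<integral>\<^sup>+u. ennreal (indicator S u * (cmod (deriv h u))\<^sup>2) \<partial>distr lborel borel complex_of_vec)
        = (\<integral>\<^sup>+x. ennreal (J x) \<partial>lborel)"
      by (subst nn_integral_distr) (auto simp: J_def V_def indicator_def)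
    then show ?thesis by (simp only: distr_lborel_complex_of_vec)
  qed
  also have "\<dots> = (\<integral>\<^sup>+x\<in>V. ennreal (J x) \<partial>lborel)"
    by (intro nn_integral_cong) (auto simp: J_def indicator_def)
  finally have integral: "(\<integral>\<^sup>+u\<in>S. ennreal ((cmod (deriv h u))\<^sup>2) \<partial>lborel) = \<dots>" .
  \<comment> \<open>Both sides take the same finite values, hence are also infinite together.\<close>
  have *: "emeasure lborel (f ` V) = ennreal m \<longleftrightarrow> (\<integral>\<^sup>+x\<in>V. ennreal (J x) \<partial>lborel) = ennreal m"
    if "0 \<le> m" for m
  proof -
    have [measurable]: "f ` V \<in> sets borel"
      unfolding fV using hS bl by (intro borel_open open_vimage linear_continuous_on)
    have le: "emeasure lebesgue (f ` V) = emeasure lborel (f ` V)"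
      by simp
    have "emeasure lborel (f ` V) = ennreal m \<longleftrightarrow> f ` V \<in> lmeasurable \<and> measure lebesgue (f ` V) = m"
    proof
      assume "emeasure lborel (f ` V) = ennreal m"
      with le have "emeasure lebesgue (f ` V) = ennreal m" by simp
      then show "f ` V \<in> lmeasurable \<and> measure lebesgue (f ` V) = m"
        using that by (intro conjI fmeasurableI measure_eq_emeasure_eq_ennreal) auto
    next
      assume "f ` V \<in> lmeasurable \<and> measure lebesgue (f ` V) = m"
      with le show "emeasure lborel (f ` V) = ennreal m"
        using emeasure_eq_measure2[of "f ` V" lebesgue] by simp
    qed
    also have "\<dots> \<longleftrightarrow> ((\<lambda>x. \<bar>det (matrix (f' x))\<bar>) has_integral m) V"
      by (rule has_measure_differentiable_image[OF _ der \<open>inj_on f V\<close>]) (use V in auto)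
    also have "\<dots> \<longleftrightarrow> (J has_integral m) V"
      by (intro has_integral_cong) (simp add: det J_def)
    also have "\<dots> \<longleftrightarrow> (\<integral>\<^sup>+x\<in>V. ennreal (J x) \<partial>lborel) = ennreal m"
      by (rule has_integral_iff_nn_integral_lborel) (use Jm that in \<open>auto simp: J_def\<close>)
    finally show ?thesis .
  qed
  show ?thesis
    unfolding emeasure integral
    using *[of "enn2real (emeasure lborel (f ` V))"] *[of "enn2real (\<integral>\<^sup>+x\<in>V. ennreal (J x) \<partial>lborel)"]
    by (cases "emeasure lborel (f ` V)"; cases "\<integral>\<^sup>+x\<in>V. ennreal (J x) \<partial>lborel") auto
qed

section \<open>Parseval's identity on the half circle\<close>

lemma has_integral_cos_half_period:
  "((\<lambda>\<theta>. cos ((real n - real m) * \<theta>)) has_integral (if n = m then pi else 0)) {0..pi}"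
proof (cases "n = m")
  case True
  then show ?thesis using has_integral_const_real[of "1::real" 0 pi] by simp
next
  case False
  define k where "k = int n - int m"
  have k: "real n - real m = of_int k" "k \<noteq> 0"
    using False by (simp_all add: k_def)
  have "((\<lambda>\<theta>. cos (of_int k * \<theta>)) has_integral (sin (of_int k * pi) / of_int k - sin (of_int k * 0) / of_int k)) {0..pi}"
    by (rule fundamental_theorem_of_calculus)
      (use k in \<open>auto intro!: derivative_eq_intros simp: has_real_derivative_iff_has_vector_derivative[symmetric]\<close>)
  moreover have "sin (of_int k * pi) = 0" by (simp add: sin_zero_iff_int2)
  ultimately show ?thesis using False by (simp add: k)
qed

lemma summable_square_if_summable_abs:
  fixes c :: "nat \<Rightarrow> real"
  assumes c: "summable (\<lambda>n. \<bar>c n\<bar>)"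
  shows "summable (\<lambda>n. (c n)\<^sup>2)"
proof (rule summable_comparison_test_ev)
  have "(\<lambda>n. \<bar>c n\<bar>) \<longlonglongrightarrow> 0" by (rule summable_LIMSEQ_zero[OF c])
  then have "\<forall>\<^sub>F n in sequentially. \<bar>c n\<bar> < 1" by (rule order_tendstoD) simp
  then show "\<forall>\<^sub>F n in sequentially. norm ((c n)\<^sup>2) \<le> \<bar>c n\<bar>"
  proof eventually_elim
    case (elim n)
    then show ?case using mult_left_le[of "\<bar>c n\<bar>" "\<bar>c n\<bar>"] by (simp add: power2_eq_square)
  qed
qed (rule c)

text \<open>
  Parseval's identity on the upper half circle. On a half period the functions
  \<open>cis (n \<theta>)\<close> are not orthogonal, but the coefficients are real, so that only
  \<open>cos ((n - m) \<theta>)\<close> enters the squared modulus, and these cosines do integrate to zero over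
  \<open>{0..pi}\<close>. Dominated convergence carries the identity from partial sums to the series.
\<close>
theorem half_circle_parseval:
  fixes c :: "nat \<Rightarrow> real"
  assumes c: "summable (\<lambda>n. \<bar>c n\<bar>)"
  shows "((\<lambda>\<theta>. (cmod (\<Sum>n. of_real (c n) * cis (real n * \<theta>)))\<^sup>2) has_integral pi * (\<Sum>n. (c n)\<^sup>2)) {0..pi}"
proof -
  define s where "s N \<theta> = (\<Sum>n<N. of_real (c n) * cis (real n * \<theta>))" for N \<theta>
  define f where "f \<theta> = (\<Sum>n. of_real (c n) * cis (real n * \<theta>))" for \<theta>
  have "(cmod (s N \<theta>))\<^sup>2 = (\<Sum>n<N. \<Sum>m<N. c n * c m * cos ((real n - real m) * \<theta>))" for N \<theta>
    unfolding s_def cmod_power2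
    by (simp add: power2_eq_square sum_product left_diff_distrib cos_diff distrib_left
        sum.distrib mult.assoc mult.left_commute)
  moreover have "((\<lambda>\<theta>. \<Sum>n<N. \<Sum>m<N. c n * c m * cos ((real n - real m) * \<theta>)) has_integral
      (\<Sum>n<N. \<Sum>m<N. c n * c m * (if n = m then pi else 0))) {0..pi}" for N
    by (intro has_integral_sum has_integral_mult_right has_integral_cos_half_period) auto
  moreover have "(\<Sum>n<N. \<Sum>m<N. c n * c m * (if n = m then pi else 0)) = pi * (\<Sum>n<N. (c n)\<^sup>2)" for N
    by (simp add: if_distrib sum_distrib_left power2_eq_square mult_ac cong: if_cong)
  ultimately have s: "((\<lambda>\<theta>. (cmod (s N \<theta>))\<^sup>2) has_integral pi * (\<Sum>n<N. (c n)\<^sup>2)) {0..pi}" for N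
    by simp
  have bound: "norm ((cmod (s N \<theta>))\<^sup>2) \<le> (\<Sum>n. \<bar>c n\<bar>)\<^sup>2" for N \<theta>
  proof -
    have "cmod (s N \<theta>) \<le> (\<Sum>n<N. \<bar>c n\<bar>)"
      unfolding s_def by (rule sum_norm_le) (simp add: norm_mult)
    also have "\<dots> \<le> (\<Sum>n. \<bar>c n\<bar>)" by (rule sum_le_suminf[OF c]) auto
    finally show ?thesis by (simp add: power_mono)
  qed
  have lim: "(\<lambda>N. (cmod (s N \<theta>))\<^sup>2) \<longlonglongrightarrow> (cmod (f \<theta>))\<^sup>2" for \<theta>
  proof -
    have "summable (\<lambda>n. of_real (c n) * cis (real n * \<theta>))"
      by (rule summable_norm_cancel) (simp add: norm_mult c)
    then have "(\<lambda>N. s N \<theta>) \<longlonglongrightarrow> f \<theta>"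
      unfolding s_def f_def by (rule summable_LIMSEQ)
    then show ?thesis by (intro tendsto_intros)
  qed
  note dc = dominated_convergence[where S = "{0..pi}" and f = "\<lambda>N \<theta>. (cmod (s N \<theta>))\<^sup>2"
      and g = "\<lambda>\<theta>. (cmod (f \<theta>))\<^sup>2", OF has_integral_integrable[OF s]
      integrable_const_ivl[of "(\<Sum>n. \<bar>c n\<bar>)\<^sup>2"] bound lim]
  have "(\<lambda>N. pi * (\<Sum>n<N. (c n)\<^sup>2)) \<longlonglongrightarrow> pi * (\<Sum>n. (c n)\<^sup>2)"
    by (intro tendsto_intros summable_LIMSEQ summable_square_if_summable_abs c)
  moreover have "integral {0..pi} (\<lambda>\<theta>. (cmod (s N \<theta>))\<^sup>2) = pi * (\<Sum>n<N. (c n)\<^sup>2)" for N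
    using s by (rule integral_unique)
  ultimately have "integral {0..pi} (\<lambda>\<theta>. (cmod (f \<theta>))\<^sup>2) = pi * (\<Sum>n. (c n)\<^sup>2)"
    using dc(2) by (metis (no_types, lifting) LIMSEQ_unique ext)
  then show ?thesis
    using dc(1) by (simp add: has_integral_iff f_def)
qed

section \<open>Uniqueness of the half plane map\<close>

text \<open>
  An entire function tending to infinity at infinity is a polynomial. Dividing out the zero at the
  origin, which is simple by injectivity, leaves a polynomial without zeros, that is, a constant.
\<close>
lemma injective_entire_fixing_0_linear:
  assumes hol: "f holomorphic_on UNIV" and inj: "inj f" and f0: "f 0 = 0"
    and lim: "filterlim f at_infinity at_infinity"
  obtains k where "k \<noteq> 0" "\<And>z. f z = k * z"
proof -
  have "((inverse \<circ> f) \<longlongrightarrow> 0) at_infinity"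
    unfolding comp_def by (rule filterlim_compose[OF tendsto_inverse_0 lim])
  then obtain a n where f: "\<And>z. f z = (\<Sum>i\<le>n. a i * z^i)"
    using pole_at_infinity[OF hol] by metis
  define n' where "n' = Suc n"
  define b where "b i = (if i \<le> n then a i else 0)" for i
  have f': "f z = (\<Sum>i\<le>n'. b i * z^i)" for z
    unfolding f by (simp add: n'_def b_def)
  have "b 0 = 0"
    using f0 by (simp add: f' sum.atMost_shift power_0_left n'_def)
  then have f'': "f z = (\<Sum>i\<le>n. b (Suc i) * z^i) * z" for z
    unfolding f' n'_def by (simp add: sum.atMost_Suc_shift sum_distrib_left mult_ac del: sum.atMost_Suc)
  define q where "q z = (\<Sum>i\<le>n. b (Suc i) * z^i)" for z
  have "(f has_field_derivative q 0) (at 0)"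
  proof -
    have "f = (\<lambda>z. q z * z)" by (simp add: f'' q_def fun_eq_iff)
    moreover have "((\<lambda>z. q z * z) has_field_derivative (deriv q 0 * 0 + q 0)) (at 0)"
    proof -
      have "q field_differentiable (at 0)"
        unfolding q_def[abs_def] field_differentiable_def
        by (rule exI) (rule derivative_eq_intros refl)+
      then have "(q has_field_derivative deriv q 0) (at 0)"
        by (simp add: field_differentiable_derivI)
      then show ?thesis by (auto intro!: derivative_eq_intros)
    qed
    ultimately show ?thesis by simp
  qed
  then have "q 0 \<noteq> 0"
    using holomorphic_injective_imp_regular[OF hol open_UNIV inj, of 0] by (auto dest: DERIV_imp_deriv)
  moreover have "q z \<noteq> 0" if "z \<noteq> 0" for z
    using inj f0 that by (metis f'' injD mult_eq_0_iff q_def)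
  ultimately have q: "q z \<noteq> 0" for z by metis
  have "b (Suc i) = 0" if "i \<in> {1..n}" for i
  proof (rule ccontr)
    assume "b (Suc i) \<noteq> 0"
    then have "b (Suc 0) = 0 \<or> (\<exists>i\<in>{1..n}. b (Suc i) \<noteq> 0)" using that by blast
    then obtain z where "(\<Sum>i\<le>n. b (Suc i) * z^i) = 0"
      by (rule Cauchy_Integral_Formula.fundamental_theorem_of_algebra)
    then show False using q[of z] by (simp add: q_def)
  qed
  then have "(\<Sum>i\<le>n. b (Suc i) * z^i) = (\<Sum>i\<le>n. if i = 0 then b (Suc 0) else 0)" for z
    by (intro sum.cong) auto
  then have "f z = b (Suc 0) * z" for z
    unfolding f'' by simp
  moreover have "b (Suc 0) \<noteq> 0"
    using injD[OF inj, of 0 1] calculation by auto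
  ultimately show ?thesis using that by blast
qed

text \<open>
  Interior points go to interior points, so the real line is mapped to itself and Schwarz reflection
  extends \<open>f\<close> to an injective entire function. Since the homeomorphism is between closures in
  the plane, without a point at infinity, preimages of bounded sets are bounded; this excludes the
  Moebius maps that move infinity.
\<close>
lemma half_plane_automorphism_linear:
  assumes hom: "homeomorphism (closure upper_half_plane) (closure upper_half_plane) f g"
    and hol: "f holomorphic_on upper_half_plane"
    and im: "f ` upper_half_plane = upper_half_plane" and f0: "f 0 = 0"
  obtains k where "k \<noteq> 0" "\<And>z. z \<in> closure upper_half_plane \<Longrightarrow> f z = k * z"
proof -
  have H: "upper_half_plane = {z. 0 < Im z}" by (simp add: upper_half_plane_def)
  note Hc = closure_upper_half_plane
  have cont: "continuous_on {z. 0 \<le> Im z} f" "continuous_on {z. 0 \<le> Im z} g"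
    and gf: "\<And>z. 0 \<le> Im z \<Longrightarrow> g (f z) = z"
    and upper: "\<And>z. 0 \<le> Im z \<Longrightarrow> 0 \<le> Im (f z)"
    using hom unfolding homeomorphism_def Hc by auto
  have interior: "0 < Im (f z)" if "0 < Im z" for z
    using im that unfolding H by auto
  have real: "Im (f z) = 0" if "Im z = 0" for z
  proof (rule ccontr)
    assume "Im (f z) \<noteq> 0"
    then have "f z \<in> f ` upper_half_plane"
      using upper[of z] that im by (simp add: H)
    then obtain w where "0 < Im w" "f z = f w" by (auto simp: H)
    then have "z = w" using gf[of z] gf[of w] that by (metis less_imp_le order_refl)
    with \<open>0 < Im w\<close> that show False by simp
  qed
  define F where "F z = (if 0 \<le> Im z then f z else cnj (f (cnj z)))" for z
  have "F holomorphic_on UNIV"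
    unfolding F_def
    by (rule Schwarz_reflection) (use hol cont real in \<open>auto simp: H complex_is_Real_iff\<close>)
  moreover have "inj F"
  proof (rule injI)
    fix z w assume eq: "F z = F w"
    have sgn: "0 \<le> Im (F z) \<longleftrightarrow> 0 \<le> Im z" for z
      using upper[of z] interior[of "cnj z"] by (auto simp: F_def not_le)
    have iff: "0 \<le> Im z \<longleftrightarrow> 0 \<le> Im w" using sgn[of z] sgn[of w] eq by simp
    show "z = w"
    proof (cases "0 \<le> Im z")
      case True
      then have "f z = f w" "0 \<le> Im w" using eq iff by (simp_all add: F_def)
      then show ?thesis using True gf by metis
    next
      case False
      then have "f (cnj z) = f (cnj w)" "0 \<le> Im (cnj z)" "0 \<le> Im (cnj w)"
        using eq iff by (simp_all add: F_def)
      then have "cnj z = cnj w" using gf by metis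
      then show ?thesis by simp
    qed
  qed
  moreover have "F 0 = 0" by (simp add: F_def f0)
  moreover have "filterlim F at_infinity at_infinity"
    unfolding filterlim_at_infinity[OF order_refl]
  proof (intro allI impI)
    fix R :: real
    have "compact (g ` (cball 0 R \<inter> {z. 0 \<le> Im z}))"
      by (intro compact_continuous_image continuous_on_subset[OF cont(2)] compact_Int_closed
          closed_Collect_le continuous_intros) auto
    then obtain B where B: "\<And>z. 0 \<le> Im z \<Longrightarrow> cmod (f z) \<le> R \<Longrightarrow> cmod z \<le> B"
      using gf upper by (force simp: bounded_iff dest!: compact_imp_bounded)
    have "R \<le> cmod (F z)" if "B + 1 \<le> cmod z" for z
    proof (rule ccontr)
      assume "\<not> R \<le> cmod (F z)"
      then show False using B[of z] B[of "cnj z"] that by (auto simp: F_def split: if_splits)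
    qed
    then show "\<forall>\<^sub>F z in at_infinity. R \<le> cmod (F z)"
      by (auto simp: eventually_at_infinity)
  qed
  ultimately obtain k where k: "k \<noteq> 0" "\<And>z. F z = k * z"
    by (rule injective_entire_fixing_0_linear) blast
  have "f z = k * z" if "z \<in> closure upper_half_plane" for z
    using k(2)[of z] that by (simp add: F_def Hc)
  with k(1) show ?thesis by (rule that)
qed

text \<open>
  Thus the conformal Neumann Green's function is unique up to an additive constant, and the sublevel
  sets of any two of them agree after rescaling the level.
\<close>
theorem half_plane_map_unique_up_to_factor:
  assumes \<Omega>: "open \<Omega>" and \<psi>: "half_plane_map \<Omega> p \<psi>" and \<xi>: "half_plane_map \<Omega> p \<xi>"
  obtains k where "k \<noteq> 0" "\<And>z. z \<in> closure \<Omega> \<Longrightarrow> \<psi> z = k * \<xi> z"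
proof -
  obtain \<phi> where \<phi>: "homeomorphism (closure \<Omega>) (closure upper_half_plane) \<psi> \<phi>"
    using \<psi> by (auto simp: half_plane_map_def)
  obtain \<eta> where \<eta>: "homeomorphism (closure \<Omega>) (closure upper_half_plane) \<xi> \<eta>"
    using \<xi> by (auto simp: half_plane_map_def)
  have hol: "\<psi> holomorphic_on \<Omega>" "\<xi> holomorphic_on \<Omega>"
    and bij: "bij_betw \<psi> \<Omega> upper_half_plane" "bij_betw \<xi> \<Omega> upper_half_plane"
    and p: "p \<in> closure \<Omega>" "\<psi> p = 0" "\<xi> p = 0"
    using \<psi> \<xi> by (auto simp: half_plane_map_def frontier_def)
  have inv: "\<eta> (\<xi> z) = z" if "z \<in> closure \<Omega>" for z
    using \<eta> that by (auto simp: homeomorphism_def)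
  have inv\<Omega>: "\<eta> (\<xi> z) = z" if "z \<in> \<Omega>" for z
    using inv closure_subset that by blast
  have H: "upper_half_plane = \<xi> ` \<Omega>" using bij(2) by (simp add: bij_betw_def)
  have \<eta>H: "\<eta> ` upper_half_plane = \<Omega>"
    using inv\<Omega> by (force simp: H image_image)
  have "\<eta> holomorphic_on upper_half_plane"
  proof -
    obtain g where g: "g holomorphic_on \<xi> ` \<Omega>" "\<And>z. z \<in> \<Omega> \<Longrightarrow> g (\<xi> z) = z"
      using holomorphic_has_inverse[OF hol(2) \<Omega>] bij(2) by (metis bij_betw_imp_inj_on)
    then show ?thesis
      unfolding H using inv\<Omega> by (subst holomorphic_cong[OF refl]) auto
  qed
  then have "(\<psi> \<circ> \<eta>) holomorphic_on upper_half_plane"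
    by (rule holomorphic_on_compose) (simp add: \<eta>H hol)
  moreover have "(\<psi> \<circ> \<eta>) ` upper_half_plane = upper_half_plane"
    unfolding image_comp[symmetric] \<eta>H using bij(1) by (simp add: bij_betw_def)
  moreover have "(\<psi> \<circ> \<eta>) 0 = 0" using inv[OF p(1)] p by simp
  ultimately obtain k where k: "k \<noteq> 0" "\<And>w. w \<in> closure upper_half_plane \<Longrightarrow> (\<psi> \<circ> \<eta>) w = k * w"
    using half_plane_automorphism_linear[OF homeomorphism_compose[OF homeomorphism_symD[OF \<eta>] \<phi>]]
    by metis
  have "\<psi> z = k * \<xi> z" if "z \<in> closure \<Omega>" for z
  proof -
    have "\<xi> z \<in> closure upper_half_plane" using \<eta> that by (auto simp: homeomorphism_def)
    then show ?thesis using k(2)[of "\<xi> z"] inv[OF that] by simp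
  qed
  with k(1) show ?thesis using that by blast
qed

section \<open>Area of the conformal image of a half disc\<close>

text \<open>
  The antiderivative of the power series with coefficients \<open>q n\<close> that vanishes at the
  origin. With \<open>q n = (b n)\<^sup>2\<close> and \<open>x = \<rho>\<^sup>2\<close> it measures the area of the image
  of a half disc of radius \<open>\<rho>\<close>.
\<close>
definition area_series :: "(nat \<Rightarrow> real) \<Rightarrow> real \<Rightarrow> real" where
  "area_series q x = (\<Sum>n. q n / real (Suc n) * x ^ Suc n)"

lemma summable_area_series:
  fixes q :: "nat \<Rightarrow> real"
  assumes "summable (\<lambda>n. q n * x ^ n)" and q: "\<And>n. 0 \<le> q n" and "0 \<le> x"
  shows "summable (\<lambda>n. q n / real (Suc n) * x ^ Suc n)"
proof (rule summable_comparison_test')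
  show "summable (\<lambda>n. x * (q n * x ^ n))" using assms(1) by (rule summable_mult)
  show "norm (q n / real (Suc n) * x ^ Suc n) \<le> x * (q n * x ^ n)" for n
    using mult_left_le[of "1 / real (Suc n)" "q n * x ^ Suc n"] q[of n] \<open>0 \<le> x\<close>
    by (simp add: abs_mult field_simps)
qed

lemma has_derivative_area_series:
  fixes q :: "nat \<Rightarrow> real"
  assumes sm: "\<And>x. 0 \<le> x \<Longrightarrow> x < 1 \<Longrightarrow> summable (\<lambda>n. q n * x ^ n)"
    and q: "\<And>n. 0 \<le> q n" and x: "\<bar>x\<bar> < 1"
  shows "(area_series q has_real_derivative (\<Sum>n. q n * x ^ n)) (at x)"
proof -
  define d where "d n = (if n = 0 then 0 else q (n - 1) / real n)" for n
  have summable_d: "summable (\<lambda>n. d n * y ^ n)" if "norm y < 1" for y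
  proof -
    have "summable (\<lambda>n. d (Suc n) * \<bar>y\<bar> ^ Suc n)"
      using summable_area_series[OF sm[of "\<bar>y\<bar>"] q] that by (simp add: d_def)
    then have "summable (\<lambda>n. d n * \<bar>y\<bar> ^ n)" by (simp only: summable_Suc_iff[of "\<lambda>n. d n * \<bar>y\<bar> ^ n"])
    then have "summable (\<lambda>n. norm (d n * y ^ n))"
      by (rule summable_cong[THEN iffD1, rotated]) (simp add: abs_mult power_abs d_def q)
    then show ?thesis by (rule summable_norm_cancel)
  qed
  have "((\<lambda>y. \<Sum>n. d n * y ^ n) has_real_derivative (\<Sum>n. diffs d n * x ^ n)) (at x)"
    by (rule termdiffs_strong'[OF summable_d]) (use x in auto)
  moreover have "diffs d = q" by (simp add: diffs_def d_def fun_eq_iff)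
  ultimately have deriv: "((\<lambda>y. \<Sum>n. d n * y ^ n) has_real_derivative (\<Sum>n. q n * x ^ n)) (at x)"
    by simp
  show ?thesis
  proof (rule has_field_derivative_transform_within_open[OF deriv])
    show "(\<Sum>n. d n * y ^ n) = area_series q y" if "y \<in> {-1<..<1}" for y
      using suminf_split_head[OF summable_d[of y]] that by (auto simp: area_series_def d_def abs_less_iff)
  qed (use x in auto)
qed

text \<open>
  This is the source of the strict inequality in the theorem: the series on the right has terms
  \<open>n + 1\<close> times as large, so a single positive coefficient of positive index makes the
  comparison strict.
\<close>
lemma area_series_less:
  fixes q :: "nat \<Rightarrow> real"
  assumes sm: "summable (\<lambda>n. q n * x ^ n)" and q: "\<And>n. 0 \<le> q n" and "0 < q 1" and "0 < x"
  shows "0 < area_series q x" "area_series q x < x * (\<Sum>n. q n * x ^ n)"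
proof -
  note sm' = summable_area_series[OF sm q less_imp_le[OF \<open>0 < x\<close>]]
  show "0 < area_series q x"
    unfolding area_series_def
    by (rule suminf_pos2[OF sm', of 1]) (use assms in auto)
  have smx: "summable (\<lambda>n. x * (q n * x ^ n))" using sm by (rule summable_mult)
  have "0 < (\<Sum>n. x * (q n * x ^ n) - q n / real (Suc n) * x ^ Suc n)"
  proof (rule suminf_pos2[OF summable_diff[OF smx sm'], of 1])
    show "0 \<le> x * (q n * x ^ n) - q n / real (Suc n) * x ^ Suc n" for n
      using mult_left_le[of "1 / real (Suc n)" "q n * x ^ Suc n"] q[of n] \<open>0 < x\<close>
      by (simp add: field_simps)
    show "0 < x * (q 1 * x ^ 1) - q 1 / real (Suc 1) * x ^ Suc 1"
      using \<open>0 < q 1\<close> \<open>0 < x\<close> by simp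
  qed
  then show "area_series q x < x * (\<Sum>n. q n * x ^ n)"
    using suminf_diff[OF smx sm'] suminf_mult[OF sm, of x] by (simp add: area_series_def)
qed

lemma summable_square_power_series:
  fixes b :: "nat \<Rightarrow> real"
  assumes sm: "\<And>x. 0 \<le> x \<Longrightarrow> x < 1 \<Longrightarrow> summable (\<lambda>n. \<bar>b n * x ^ n\<bar>)"
    and x: "0 \<le> x" "x < 1"
  shows "summable (\<lambda>n. (b n)\<^sup>2 * x ^ n)"
proof -
  have "(sqrt x ^ n)\<^sup>2 = x ^ n" for n
    using x by (metis mult.commute power_mult real_sqrt_pow2)
  then show ?thesis
    using summable_square_if_summable_abs[OF sm[of "sqrt x"]] x
    by (simp add: power_mult_distrib)
qed

text \<open>
  The exponential maps this strip bijectively onto the upper half disc of radius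
  \<open>exp L\<close>. It replaces polar coordinates, with the advantage of being conformal, so that
  the area formula applies to compositions with it.
\<close>
definition half_strip :: "real \<Rightarrow> complex set" where
  "half_strip L = {u. Re u < L \<and> 0 < Im u \<and> Im u < pi}"

lemma open_half_strip: "open (half_strip L)"
proof -
  have "half_strip L = {u. Re u < L} \<inter> {u. 0 < Im u} \<inter> {u. Im u < pi}"
    by (auto simp: half_strip_def)
  then show ?thesis
    by (simp only: open_Int open_halfspace_Re_lt open_halfspace_Im_gt open_halfspace_Im_lt)
qed

lemma nn_integral_complex:
  assumes [measurable]: "f \<in> borel_measurable borel"
  shows "(\<integral>\<^sup>+u. f u \<partial>lborel) = (\<integral>\<^sup>+x. \<integral>\<^sup>+y. f (Complex x y) \<partial>lborel \<partial>lborel)"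
proof -
  have "continuous_on UNIV (\<lambda>(x, y). Complex x y)"
    unfolding case_prod_beta Complex_eq by (intro continuous_intros)
  then have [measurable]: "(\<lambda>(x, y). Complex x y) \<in> borel_measurable (lborel \<Otimes>\<^sub>M lborel)"
    unfolding lborel_prod by (simp add: borel_measurable_continuous_onI)
  have "(\<integral>\<^sup>+u. f u \<partial>lborel) = (\<integral>\<^sup>+u. f u \<partial>distr (lborel \<Otimes>\<^sub>M lborel) borel (\<lambda>(x, y). Complex x y))"
    by (simp only: distr_lborel_Complex)
  also have "\<dots> = (\<integral>\<^sup>+p. f (case p of (x, y) \<Rightarrow> Complex x y) \<partial>(lborel \<Otimes>\<^sub>M lborel))"
    by (rule nn_integral_distr) auto
  also have "\<dots> = (\<integral>\<^sup>+x. \<integral>\<^sup>+y. f (Complex x y) \<partial>lborel \<partial>lborel)"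
    by (subst lborel.nn_integral_fst[symmetric]) auto
  finally show ?thesis .
qed

text \<open>
  If \<open>F'(w)\<close> is the power series with coefficients \<open>b n\<close>, the integrand is the squared
  modulus of the derivative of \<open>F (exp u)\<close>. Integrating over vertical segments is Parseval's
  identity on half circles; the remaining integral over \<open>Re u\<close> is found from an explicit
  antiderivative, a multiple of \<open>area_series\<close> at \<open>(exp (Re u))\<^sup>2\<close>.
\<close>
theorem half_strip_integral:
  fixes b :: "nat \<Rightarrow> real"
  assumes sm: "\<And>x. 0 \<le> x \<Longrightarrow> x < 1 \<Longrightarrow> summable (\<lambda>n. \<bar>b n * x ^ n\<bar>)"
    and \<rho>: "0 < \<rho>" "\<rho> < 1"
  shows "(\<integral>\<^sup>+u\<in>half_strip (ln \<rho>). ennreal ((cmod ((\<Sum>n. of_real (b n) * exp u ^ n) * exp u))\<^sup>2) \<partial>lborel)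
    = ennreal (pi / 2 * area_series (\<lambda>n. (b n)\<^sup>2) (\<rho>\<^sup>2))"
proof -
  define q where "q n = (b n)\<^sup>2" for n
  define f where "f u = (cmod ((\<Sum>n. of_real (b n) * exp u ^ n) * exp u))\<^sup>2" for u :: complex
  define I where "I x = (exp x)\<^sup>2 * (pi * (\<Sum>n. q n * ((exp x)\<^sup>2) ^ n))" for x :: real
  have smq: "summable (\<lambda>n. q n * x ^ n)" if "0 \<le> x" "x < 1" for x
    unfolding q_def by (rule summable_square_power_series[OF sm that])
  have [measurable]: "f \<in> borel_measurable borel"
    unfolding f_def[abs_def] by measurable
  have [measurable]: "half_strip L \<in> sets borel" for L
    using open_half_strip by simp
  have f: "f (Complex x y) = (exp x)\<^sup>2 * (cmod (\<Sum>n. of_real (b n * exp x ^ n) * cis (real n * y)))\<^sup>2" for x y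
  proof -
    have e: "exp (Complex x y) = of_real (exp x) * cis y" by (simp add: exp_eq_polar)
    have "of_real (b n) * exp (Complex x y) ^ n = of_real (b n * exp x ^ n) * cis (real n * y)" for n
      by (simp add: e power_mult_distrib Complex.DeMoivre)
    then have "f (Complex x y) = (cmod ((\<Sum>n. of_real (b n * exp x ^ n) * cis (real n * y)) * exp (Complex x y)))\<^sup>2"
      by (simp only: f_def)
    then show ?thesis by (simp only: norm_mult power_mult_distrib norm_exp_eq_Re complex.sel mult.commute)
  qed
  have inner: "(\<integral>\<^sup>+y. ennreal (f (Complex x y)) * indicator {0<..<pi} y \<partial>lborel) = ennreal (I x)" if "x < 0" for x
  proof -
    have "((\<lambda>y. f (Complex x y)) has_integral (exp x)\<^sup>2 * (pi * (\<Sum>n. (b n * exp x ^ n)\<^sup>2))) {0..pi}"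
      unfolding f by (intro has_integral_mult_right half_circle_parseval sm) (use that in auto)
    also have "(exp x)\<^sup>2 * (pi * (\<Sum>n. (b n * exp x ^ n)\<^sup>2)) = I x"
      by (simp add: I_def q_def power_mult_distrib power_mult[symmetric] mult.commute)
    finally have "((\<lambda>y. f (Complex x y)) has_integral I x) {0<..<pi}"
      using has_integral_open_interval[of "\<lambda>y. f (Complex x y)" "I x" 0 pi] by (simp only: box_real cbox_interval)
    then have "(\<integral>\<^sup>+y. ennreal (indicator {0<..<pi} y * f (Complex x y)) \<partial>lborel) = ennreal (I x)"
      by (intro nn_integral_has_integral_lebesgue) (simp add: f_def)
    moreover have "ennreal (f (Complex x y)) * indicator {0<..<pi} y = ennreal (indicator {0<..<pi} y * f (Complex x y))" for y
      by (auto simp: indicator_def)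
    ultimately show ?thesis by (simp only:)
  qed
  have "(\<integral>\<^sup>+u\<in>half_strip (ln \<rho>). ennreal (f u) \<partial>lborel) =
      (\<integral>\<^sup>+x. \<integral>\<^sup>+y. ennreal (f (Complex x y)) * indicator (half_strip (ln \<rho>)) (Complex x y) \<partial>lborel \<partial>lborel)"
    by (intro nn_integral_complex borel_measurable_times_ennreal borel_measurable_indicator
        measurable_compose[OF \<open>f \<in> borel_measurable borel\<close> measurable_ennreal]) (simp add: open_half_strip)
  also have "\<dots> = (\<integral>\<^sup>+x. \<integral>\<^sup>+y. indicator {..<ln \<rho>} x * (ennreal (f (Complex x y)) * indicator {0<..<pi} y) \<partial>lborel \<partial>lborel)"
    by (intro nn_integral_cong) (auto simp: half_strip_def indicator_def)
  also have "\<dots> = (\<integral>\<^sup>+x. indicator {..<ln \<rho>} x * ennreal (I x) \<partial>lborel)"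
  proof (intro nn_integral_cong)
    fix x
    have [measurable]: "(\<lambda>y. f (Complex x y)) \<in> borel_measurable borel"
      unfolding Complex_eq by measurable
    show "(\<integral>\<^sup>+y. indicator {..<ln \<rho>} x * (ennreal (f (Complex x y)) * indicator {0<..<pi} y) \<partial>lborel)
        = indicator {..<ln \<rho>} x * ennreal (I x)"
      using inner[of x] ln_less_zero[OF \<rho>] by (subst nn_integral_cmult) (auto simp: indicator_def)
  qed
  also have "\<dots> = ennreal (pi / 2 * area_series q (\<rho>\<^sup>2))"
  proof -
    define P where "P x = pi / 2 * area_series q ((exp x)\<^sup>2)" for x
    have ex: "(exp x)\<^sup>2 < 1" if "x < 0" for x :: real
      using that by (simp add: power_less_one_iff)
    have I0: "0 \<le> I x" if "x < 0" for x
      unfolding I_def by (intro mult_nonneg_nonneg suminf_nonneg smq ex that) (auto simp: q_def)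
    have dT: "(area_series q has_real_derivative (\<Sum>n. q n * x ^ n)) (at x)" if "\<bar>x\<bar> < 1" for x
      by (rule has_derivative_area_series[OF smq]) (use that in \<open>auto simp: q_def\<close>)
    have dP: "(P has_real_derivative I x) (at x)" if "x < 0" for x
    proof -
      have abs: "\<bar>(exp x)\<^sup>2\<bar> < 1" using ex[OF that] by simp
      have "((\<lambda>x::real. (exp x)\<^sup>2) has_real_derivative 2 * (exp x)\<^sup>2) (at x)"
        by (auto intro!: derivative_eq_intros simp: power2_eq_square)
      from DERIV_chain2[where g = "\<lambda>x. (exp x)\<^sup>2", OF dT[OF abs] this]
      have "((\<lambda>x. area_series q ((exp x)\<^sup>2)) has_real_derivative
          (\<Sum>n. q n * ((exp x)\<^sup>2) ^ n) * (2 * (exp x)\<^sup>2)) (at x)"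
        .
      then have "(P has_real_derivative pi / 2 * ((\<Sum>n. q n * ((exp x)\<^sup>2) ^ n) * (2 * (exp x)\<^sup>2))) (at x)"
        unfolding P_def[abs_def] by (rule DERIV_cmult)
      then show ?thesis by (rule DERIV_cong) (simp add: I_def)
    qed
    have cI: "isCont I x" if "x < 0" for x
    proof -
      have "isCont (\<lambda>y. \<Sum>n. q n * y ^ n) ((exp x)\<^sup>2)"
        by (rule isCont_powser[OF smq[of "((exp x)\<^sup>2 + 1) / 2"]]) (use ex[OF that] in auto)
      then have "isCont (\<lambda>x. \<Sum>n. q n * ((exp x)\<^sup>2) ^ n) x"
        by (rule isCont_o2[rotated]) (intro continuous_intros)
      then show ?thesis
        unfolding I_def[abs_def] by (intro continuous_intros)
    qed
    have L: "ln \<rho> < 0" using \<rho> by simp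
    have neg: "x < 0" if "ereal x < ereal (ln \<rho>)" for x using that L by simp
    have limA: "((P \<circ> real_of_ereal) \<longlongrightarrow> 0) (at_right (-\<infinity>))"
    proof -
      have "((\<lambda>x::real. (exp x)\<^sup>2) \<longlongrightarrow> 0\<^sup>2) at_bot"
        by (intro tendsto_intros exp_at_bot)
      moreover have "isCont (area_series q) 0"
        using dT[of 0] by (intro DERIV_isCont) auto
      ultimately have "((\<lambda>x::real. area_series q ((exp x)\<^sup>2)) \<longlongrightarrow> area_series q 0) at_bot"
        using isCont_tendsto_compose[of 0 "area_series q" "\<lambda>x::real. (exp x)\<^sup>2" at_bot] by simp
      then have "(P \<longlongrightarrow> pi / 2 * area_series q 0) at_bot"
        unfolding P_def[abs_def] by (intro tendsto_intros)
      then show ?thesis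
        by (simp add: area_series_def ereal_tendsto_simps)
    qed
    have limB: "((P \<circ> real_of_ereal) \<longlongrightarrow> P (ln \<rho>)) (at_left (ereal (ln \<rho>)))"
    proof -
      have "isCont P (ln \<rho>)" using dP[OF L] by (rule DERIV_isCont)
      then have "(P \<longlongrightarrow> P (ln \<rho>)) (at_left (ln \<rho>))"
        unfolding isCont_def by (rule tendsto_mono[OF at_le[OF subset_UNIV]])
      then show ?thesis by (simp add: ereal_tendsto_simps)
    qed
    have nonneg: "AE x in lborel. -\<infinity> < ereal x \<longrightarrow> ereal x < ereal (ln \<rho>) \<longrightarrow> 0 \<le> I x"
      by (intro AE_I2 impI I0 neg)
    note FTC = interval_integral_FTC_nonneg[of "-\<infinity>" "ereal (ln \<rho>)" P I, OF _ dP[OF neg] cI[OF neg] nonneg limA limB]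
    have S: "einterval (-\<infinity>) (ereal (ln \<rho>)) = {..<ln \<rho>}"
      by (auto simp: einterval_def)
    have int: "integrable lborel (\<lambda>x. indicator {..<ln \<rho>} x * I x)"
      using FTC(1) by (simp add: S set_integrable_def)
    have "(\<integral>\<^sup>+x. indicator {..<ln \<rho>} x * ennreal (I x) \<partial>lborel) = (\<integral>\<^sup>+x. ennreal (indicator {..<ln \<rho>} x * I x) \<partial>lborel)"
      by (intro nn_integral_cong) (auto simp: indicator_def)
    also have "\<dots> = ennreal (\<integral>x. indicator {..<ln \<rho>} x * I x \<partial>lborel)"
      using int by (rule nn_integral_eq_integral) (use I0 L in \<open>auto simp: indicator_def\<close>)
    also have "(\<integral>x. indicator {..<ln \<rho>} x * I x \<partial>lborel) = P (ln \<rho>)"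
      using FTC(2) by (simp add: interval_lebesgue_integral_def set_lebesgue_integral_def S)
    finally show ?thesis using \<rho> by (simp add: P_def)
  qed
  finally show ?thesis by (simp add: f_def q_def[abs_def])
qed

section \<open>Sublevel sets in the sector\<close>

text \<open>
  In the coordinate \<open>w = exp u\<close> this is the inverse of \<open>sector_map\<close> after dividing the
  latter by \<open>(\<alpha> a) powr (1/\<alpha>)\<close>. The normalisation puts the corner of the sector at
  \<open>w = -1\<close>, so the binomial series of the derivative converges on the disc reaching that point.
\<close>
definition sector_chart :: "real \<Rightarrow> real \<Rightarrow> complex \<Rightarrow> complex" where
  "sector_chart \<alpha> a u = of_real a * (1 + exp u) powr of_real \<alpha>"

lemma Im_exp_pos:
  assumes "0 < Im u" "Im u < pi"
  shows "0 < Im (exp u)"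
  using assms by (simp add: Im_exp sin_gt_zero)

lemma sector_chart:
  assumes \<alpha>: "0 < \<alpha>" "\<alpha> < 1" and a: "0 < a" and u: "0 < Im u" "Im u < pi"
  shows "sector_chart \<alpha> a u \<in> sector \<alpha>"
    and "sector_map \<alpha> a (sector_chart \<alpha> a u) = of_real ((\<alpha> * a) powr (1 / \<alpha>)) * exp u"
proof -
  have "Im (1 + exp u) > 0" using Im_exp_pos[OF u] by simp
  then obtain t \<theta> where pol: "1 + exp u = of_real t * cis \<theta>" and t: "t > 0" "0 < \<theta>" "\<theta> < pi"
    using upper_polar[of "1 + exp u"] by (metis less_imp_le)
  have chart: "sector_chart \<alpha> a u = of_real (a * t powr \<alpha>) * cis (\<alpha> * \<theta>)"
    using powr_polar[of t \<theta> \<alpha>] t by (simp add: sector_chart_def pol)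
  have \<alpha>\<theta>: "0 < \<alpha> * \<theta>" "\<alpha> * \<theta> < pi * \<alpha>" "\<alpha> * \<theta> < pi"
    using \<alpha> t mult_strict_mono[of \<alpha> 1 \<theta> pi] by auto
  show "sector_chart \<alpha> a u \<in> sector \<alpha>"
  proof -
    have "0 < a * t powr \<alpha>" using a t by simp
    then show ?thesis unfolding chart sector_def using \<alpha>\<theta>(1,2) by blast
  qed
  have "(of_real \<alpha> * sector_chart \<alpha> a u) powr of_real (1 / \<alpha>)
      = (of_real (\<alpha> * (a * t powr \<alpha>)) * cis (\<alpha> * \<theta>)) powr of_real (1 / \<alpha>)"
    by (simp add: chart mult.assoc)
  also have "\<dots> = of_real ((\<alpha> * (a * t powr \<alpha>)) powr (1 / \<alpha>)) * cis (1 / \<alpha> * (\<alpha> * \<theta>))"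
    by (rule powr_polar) (use \<alpha> a \<alpha>\<theta> in auto)
  also have "\<dots> = of_real ((\<alpha> * a) powr (1 / \<alpha>)) * (1 + exp u)"
    using \<alpha> a t by (simp add: pol powr_mult powr_powr)
  finally have 1: "(of_real \<alpha> * sector_chart \<alpha> a u) powr of_real (1 / \<alpha>) = of_real ((\<alpha> * a) powr (1 / \<alpha>)) * (1 + exp u)" .
  have 2: "(of_real \<alpha> * of_real a) powr of_real (1 / \<alpha>) = (of_real ((\<alpha> * a) powr (1 / \<alpha>)) :: complex)"
    using powr_polar[of "\<alpha> * a" 0 "1 / \<alpha>"] \<alpha> a by simp
  show "sector_map \<alpha> a (sector_chart \<alpha> a u) = of_real ((\<alpha> * a) powr (1 / \<alpha>)) * exp u"
    unfolding sector_map_def 1 2 by (simp add: algebra_simps)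
qed

lemma sector_map_sublevel:
  assumes \<alpha>: "0 < \<alpha>" "\<alpha> < 1" and a: "0 < a" and \<rho>: "0 < \<rho>"
  shows "{z \<in> sector \<alpha>. cmod (sector_map \<alpha> a z) < (\<alpha> * a) powr (1 / \<alpha>) * \<rho>}
    = sector_chart \<alpha> a ` half_strip (ln \<rho>)"
proof -
  define c where "c = (\<alpha> * a) powr (1 / \<alpha>)"
  have c: "0 < c" using \<alpha> a by (simp add: c_def)
  have norm: "cmod (of_real c * exp u) < c * \<rho> \<longleftrightarrow> Re u < ln \<rho>" for u
    using c \<rho> exp_less_cancel_iff[of "Re u" "ln \<rho>"] by (simp add: norm_mult)
  have chart: "sector_chart \<alpha> a u \<in> sector \<alpha>" "sector_map \<alpha> a (sector_chart \<alpha> a u) = of_real c * exp u"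
    if "0 < Im u" "Im u < pi" for u
    unfolding c_def by (fact sector_chart[OF \<alpha> a that])+
  have bij: "bij_betw (sector_map \<alpha> a) (sector \<alpha>) upper_half_plane"
    using sector_map_half_plane_map[OF \<alpha> a] by (simp add: half_plane_map_def)
  have "z \<in> sector_chart \<alpha> a ` half_strip (ln \<rho>)"
    if z: "z \<in> sector \<alpha>" "cmod (sector_map \<alpha> a z) < c * \<rho>" for z
  proof -
    define w where "w = sector_map \<alpha> a z / of_real c"
    have "0 < Im (sector_map \<alpha> a z)"
      using bij_betw_apply[OF bij z(1)] by (simp add: upper_half_plane_def)
    then have w: "0 < Im w" using c by (simp add: w_def)
    then have "w \<noteq> 0" by auto
    then have cw: "of_real c * exp (Ln w) = sector_map \<alpha> a z" using c by (simp add: w_def)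
    note Ln = Im_Ln_pos_lt_imp[OF w]
    have "Ln w \<in> half_strip (ln \<rho>)"
      using Ln z(2) norm[of "Ln w"] by (simp add: half_strip_def cw)
    moreover have "sector_chart \<alpha> a (Ln w) = z"
      using bij_betw_imp_inj_on[OF bij] z(1) chart[of "Ln w"] Ln cw by (auto dest: inj_onD)
    ultimately show ?thesis by blast
  qed
  then show ?thesis
    unfolding c_def[symmetric] using chart norm by (auto simp: half_strip_def)
qed

lemma has_field_derivative_sector_chart:
  assumes "0 < Im u" "Im u < pi"
  shows "(sector_chart \<alpha> a has_field_derivative
    of_real (a * \<alpha>) * ((1 + exp u) powr of_real (\<alpha> - 1) * exp u)) (at u)"
proof -
  have "1 + exp u \<notin> \<real>\<^sub>\<le>\<^sub>0"
    using Im_exp_pos[OF assms] by (auto simp: complex_nonpos_Reals_iff)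
  then show ?thesis
    unfolding sector_chart_def[abs_def]
    by (auto intro!: derivative_eq_intros)
qed

lemma sector_chart_holomorphic: "sector_chart \<alpha> a holomorphic_on half_strip L"
  unfolding holomorphic_on_def field_differentiable_def
proof (intro ballI exI)
  fix u assume "u \<in> half_strip L"
  then have "0 < Im u" "Im u < pi" by (auto simp: half_strip_def)
  from has_field_derivative_at_within[OF has_field_derivative_sector_chart[OF this]]
  show "(sector_chart \<alpha> a has_field_derivative
      of_real (a * \<alpha>) * ((1 + exp u) powr of_real (\<alpha> - 1) * exp u)) (at u within half_strip L)" .
qed

lemma inj_on_sector_chart:
  assumes \<alpha>: "0 < \<alpha>" "\<alpha> < 1" and a: "0 < a"
  shows "inj_on (sector_chart \<alpha> a) (half_strip L)"
proof (rule inj_onI)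
  fix u v assume u: "u \<in> half_strip L" and v: "v \<in> half_strip L"
    and eq: "sector_chart \<alpha> a u = sector_chart \<alpha> a v"
  have "of_real ((\<alpha> * a) powr (1 / \<alpha>)) * exp u = of_real ((\<alpha> * a) powr (1 / \<alpha>)) * exp v"
    using sector_chart(2)[OF \<alpha> a, of u] sector_chart(2)[OF \<alpha> a, of v] u v eq
    by (auto simp: half_strip_def)
  then have "exp u = exp v" using \<alpha> a by simp
  then have "Ln (exp u) = Ln (exp v)" by simp
  then show "u = v" using u v by (simp add: half_strip_def)
qed

text \<open>
  The sector is exhausted by the sublevel sets of its half plane map, which are open as injective
  holomorphic images of half strips.
\<close>
lemma open_sector:
  assumes \<alpha>: "0 < \<alpha>" "\<alpha> < 1"
  shows "open (sector \<alpha>)"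
proof -
  let ?c = "(\<alpha> * 1) powr (1 / \<alpha>)"
  have "sector \<alpha> = (\<Union>\<rho>\<in>{0<..}. {z \<in> sector \<alpha>. cmod (sector_map \<alpha> 1 z) < ?c * \<rho>})"
  proof -
    have "\<exists>\<rho>>0. cmod (sector_map \<alpha> 1 z) < ?c * \<rho>" for z
      using \<alpha> by (intro exI[of _ "(cmod (sector_map \<alpha> 1 z) + 1) / ?c"]) (auto simp: add_nonneg_pos)
    then show ?thesis by auto
  qed
  also have "\<dots> = (\<Union>\<rho>\<in>{0<..}. sector_chart \<alpha> 1 ` half_strip (ln \<rho>))"
    using sector_map_sublevel[OF \<alpha>, of 1] by (intro SUP_cong refl) auto
  also have "open \<dots>"
    by (intro open_UN ballI open_mapping_thm3 sector_chart_holomorphic open_half_strip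
        inj_on_sector_chart \<alpha>) simp
  finally show ?thesis .
qed

lemma summable_abs_gbinomial:
  fixes \<beta> x :: real
  assumes "0 \<le> x" "x < 1"
  shows "summable (\<lambda>n. \<bar>(\<beta> gchoose n) * x ^ n\<bar>)"
proof -
  have "summable (\<lambda>n. (\<beta> gchoose n) * ((x + 1) / 2) ^ n)"
    using gen_binomial_real[of "(x + 1) / 2" \<beta>] assms by (simp add: sums_iff)
  from powser_insidea[OF this, of x] show ?thesis
    using assms by simp
qed

theorem sector_map_sublevel_area:
  assumes \<alpha>: "0 < \<alpha>" "\<alpha> < 1" and a: "0 < a" and \<rho>: "0 < \<rho>" "\<rho> < 1"
  shows "measure lborel {z \<in> sector \<alpha>. cmod (sector_map \<alpha> a z) < (\<alpha> * a) powr (1 / \<alpha>) * \<rho>}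
    = (a * \<alpha>)\<^sup>2 * pi / 2 * area_series (\<lambda>n. ((\<alpha> - 1) gchoose n)\<^sup>2) (\<rho>\<^sup>2)"
proof -
  define b where "b n = (\<alpha> - 1) gchoose n" for n
  define S where "S = half_strip (ln \<rho>)"
  define g where "g u = (\<Sum>n. of_real (b n) * exp u ^ n) * exp u" for u :: complex
  have [measurable]: "S \<in> sets borel" by (simp add: S_def open_half_strip)
  have b: "of_real (b n) = (of_real (\<alpha> - 1) gchoose n :: complex)" for n
    by (simp add: b_def gbinomial_prod_rev)
  have deriv: "deriv (sector_chart \<alpha> a) u = of_real (a * \<alpha>) * g u" if "u \<in> S" for u
  proof -
    have "exp (Re u) < \<rho>"
      using that \<rho> exp_less_cancel_iff[of "Re u" "ln \<rho>"] by (simp add: S_def half_strip_def)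
    with \<rho>(2) have "cmod (exp u) < 1" unfolding norm_exp_eq_Re by linarith
    from gen_binomial_complex[OF this, of "of_real (\<alpha> - 1)"]
    have "(1 + exp u) powr of_real (\<alpha> - 1) = (\<Sum>n. of_real (b n) * exp u ^ n)"
      by (simp add: b sums_iff)
    then show ?thesis
      using has_field_derivative_sector_chart[of u \<alpha> a] that
      by (auto simp: S_def half_strip_def g_def dest: DERIV_imp_deriv)
  qed
  have [measurable]: "g \<in> borel_measurable borel"
    unfolding g_def[abs_def] by measurable
  have "emeasure lborel (sector_chart \<alpha> a ` S) = (\<integral>\<^sup>+u\<in>S. ennreal ((cmod (deriv (sector_chart \<alpha> a) u))\<^sup>2) \<partial>lborel)"
    unfolding S_def by (intro area_conformal_image open_half_strip sector_chart_holomorphic inj_on_sector_chart \<alpha> a)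
  also have "\<dots> = (\<integral>\<^sup>+u. ennreal ((a * \<alpha>)\<^sup>2) * (ennreal ((cmod (g u))\<^sup>2) * indicator S u) \<partial>lborel)"
  proof (intro nn_integral_cong)
    fix u
    show "ennreal ((cmod (deriv (sector_chart \<alpha> a) u))\<^sup>2) * indicator S u
        = ennreal ((a * \<alpha>)\<^sup>2) * (ennreal ((cmod (g u))\<^sup>2) * indicator S u)"
      using deriv[of u]
      by (auto simp: indicator_def norm_mult power_mult_distrib ennreal_mult' mult.assoc)
  qed
  also have "\<dots> = ennreal ((a * \<alpha>)\<^sup>2) * (\<integral>\<^sup>+u\<in>S. ennreal ((cmod (g u))\<^sup>2) \<partial>lborel)"
    by (rule nn_integral_cmult) measurable
  also have "(\<integral>\<^sup>+u\<in>S. ennreal ((cmod (g u))\<^sup>2) \<partial>lborel) = ennreal (pi / 2 * area_series (\<lambda>n. (b n)\<^sup>2) (\<rho>\<^sup>2))"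
    unfolding S_def g_def
    by (rule half_strip_integral) (use \<rho> summable_abs_gbinomial in \<open>auto simp: b_def\<close>)
  finally have "emeasure lborel (sector_chart \<alpha> a ` S)
      = ennreal ((a * \<alpha>)\<^sup>2 * (pi / 2 * area_series (\<lambda>n. (b n)\<^sup>2) (\<rho>\<^sup>2)))"
    by (simp only: ennreal_mult'[OF zero_le_power2])
  moreover have "0 < area_series (\<lambda>n. (b n)\<^sup>2) (\<rho>\<^sup>2)"
    unfolding b_def by (rule area_series_less(1)[OF summable_square_power_series[OF summable_abs_gbinomial]])
      (use \<alpha> \<rho> in \<open>auto simp: power_less_one_iff\<close>)
  ultimately show ?thesis
    unfolding sector_map_sublevel[OF \<alpha> a \<rho>(1)] S_def[symmetric] b_def[symmetric]
    by (simp add: measure_def)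
qed

theorem proposition7:
  fixes \<alpha> a :: real and G :: "complex \<Rightarrow> real"
  assumes "0 < \<alpha>" and "\<alpha> < 1" and "0 < a"
    and "conformal_neumann_green (sector \<alpha>) (of_real a) G"
  shows "\<forall>\<^sub>F r in at_right 0.
           sublevel_area (sector \<alpha>) G field_differentiable at r \<and>
           4 / r - 2 * deriv (sublevel_area (sector \<alpha>) G) r / sublevel_area (sector \<alpha>) G r < 0"
proof -
  note \<alpha> = assms(1,2) and a = assms(3)
  obtain \<psi> where \<psi>: "half_plane_map (sector \<alpha>) (of_real a) \<psi>"
    and G: "\<And>z. z \<in> closure (sector \<alpha>) - {of_real a} \<Longrightarrow> G z = ln (cmod (\<psi> z))"
    using assms(4) by (auto simp: conformal_neumann_green_def)
  obtain k where k: "k \<noteq> 0" "\<And>z. z \<in> closure (sector \<alpha>) \<Longrightarrow> \<psi> z = k * sector_map \<alpha> a z"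
    using half_plane_map_unique_up_to_factor[OF open_sector[OF \<alpha>] \<psi> sector_map_half_plane_map[OF \<alpha> a]]
    by metis
  define c where "c = (\<alpha> * a) powr (1 / \<alpha>)"
  define \<kappa> where "\<kappa> = cmod k * c"
  define q where "q n = ((\<alpha> - 1) gchoose n)\<^sup>2" for n
  define C where "C = (a * \<alpha>)\<^sup>2 * pi / 2"
  define A where "A = sublevel_area (sector \<alpha>) G"
  have pos: "0 < c" "0 < \<kappa>" "0 < C"
    using \<alpha> a k by (auto simp: c_def \<kappa>_def C_def)
  have q: "0 \<le> q n" "0 < q 1" for n
    using \<alpha> by (auto simp: q_def)
  have smq: "summable (\<lambda>n. q n * x ^ n)" if "0 \<le> x" "x < 1" for x
    unfolding q_def by (rule summable_square_power_series[OF summable_abs_gbinomial that])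
  have sublevel: "sublevel (sector \<alpha>) G r = {z \<in> sector \<alpha>. cmod (sector_map \<alpha> a z) < c * (r / \<kappa>)}"
    if "0 < r" for r
  proof -
    have "G z < ln r \<longleftrightarrow> cmod (sector_map \<alpha> a z) < c * (r / \<kappa>)" if z: "z \<in> sector \<alpha>" for z
    proof -
      have cl: "z \<in> closure (sector \<alpha>)" using z closure_subset by blast
      \<comment> \<open>The values of \<open>G\<close> are prescribed away from the pole only.\<close>
      have "of_real a \<notin> sector \<alpha>"
        using \<psi> open_sector[OF \<alpha>] by (simp add: half_plane_map_def frontier_def interior_open)
      then have "G z = ln (cmod (\<psi> z))" using z cl by (intro G) auto
      moreover have "\<psi> z \<in> upper_half_plane"
        using \<psi> z by (auto simp: half_plane_map_def bij_betw_def)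
      then have "0 < cmod (\<psi> z)" by (auto simp: upper_half_plane_def)
      ultimately have "G z < ln r \<longleftrightarrow> cmod k * cmod (sector_map \<alpha> a z) < r"
        using \<open>0 < r\<close> k(2)[OF cl] by (simp add: norm_mult)
      also have "\<dots> \<longleftrightarrow> cmod (sector_map \<alpha> a z) < c * (r / \<kappa>)"
        using k(1) pos by (simp add: \<kappa>_def field_simps)
      finally show ?thesis .
    qed
    then show ?thesis by (auto simp: sublevel_def)
  qed
  have area: "A r = C * area_series q ((r / \<kappa>)\<^sup>2)" if "r \<in> {0<..<\<kappa>}" for r
  proof -
    have "0 < r / \<kappa>" "r / \<kappa> < 1" using that by auto
    from sector_map_sublevel_area[OF \<alpha> a this] sublevel[of r] that show ?thesis
      by (simp add: A_def sublevel_area_def c_def C_def q_def[abs_def])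
  qed
  have "A field_differentiable at r \<and> 4 / r - 2 * deriv A r / A r < 0" if r: "0 < r" "r < \<kappa>" for r
  proof -
    define x where "x = (r / \<kappa>)\<^sup>2"
    define D where "D = (\<Sum>n. q n * x ^ n)"
    have x: "0 < x" "x < 1" using r by (auto simp: x_def power_less_one_iff)
    have "(area_series q has_real_derivative D) (at ((r / \<kappa>)\<^sup>2))"
      unfolding D_def x_def[symmetric]
      by (rule has_derivative_area_series[OF smq q(1)]) (use x in auto)
    moreover have "((\<lambda>r. (r / \<kappa>)\<^sup>2) has_real_derivative 2 * x / r) (at r)"
      using pos r by (auto intro!: derivative_eq_intros simp: x_def power2_eq_square field_simps)
    ultimately have "((\<lambda>r. area_series q ((r / \<kappa>)\<^sup>2)) has_real_derivative D * (2 * x / r)) (at r)"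
      by (rule DERIV_chain2)
    then have "((\<lambda>r. C * area_series q ((r / \<kappa>)\<^sup>2)) has_real_derivative C * (D * (2 * x / r))) (at r)"
      by (rule DERIV_cmult)
    then have der: "(A has_real_derivative C * (D * (2 * x / r))) (at r)"
      by (rule has_field_derivative_transform_within_open[of _ _ _ "{0<..<\<kappa>}"]) (use r area in auto)
    have T: "0 < area_series q x" "area_series q x < x * D"
      unfolding D_def using area_series_less[OF smq q(1) q(2), of x] x by auto
    have "A r = C * area_series q x" using area[of r] r by (simp add: x_def)
    then have "2 * deriv A r / A r = 4 / r * (x * D / area_series q x)"
      using r pos T by (simp add: DERIV_imp_deriv[OF der] field_simps)
    moreover have "4 / r * 1 < 4 / r * (x * D / area_series q x)"
      by (rule mult_strict_left_mono) (use T r in auto)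
    ultimately have "4 / r - 2 * deriv A r / A r < 0" by simp
    then show ?thesis
      using der by (auto simp: field_differentiable_def)
  qed
  then show ?thesis
    unfolding A_def[symmetric] eventually_at_right_field using pos(2) by blast
qed

end
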